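(* Let $X$ be a real separable Hilbert space and $X^*$ its dual space. Assume: 1) $J:X\to\mathbb R$ is a finite weakly continuous convex functional, and for $\varepsilon>0$, $J_\varepsilon:X\to\mathbb R$ is convex and such that $J_\varepsilon(v)\to J(v)$ uniformly on $X$ as $\varepsilon\to0$, and the Gateaux derivative $DJ_\varepsilon\equiv A_\varepsilon:X\to X^*$ is weakly continuous with $A_\varepsilon(0_X)=0_{X^*}$. 2) $a:X\times X\times X\to\mathbb R$ is a form such that: for each $w\in X$, $(u,v)\mapsto a(w,u,v)$ is bilinear on $X\times X$; there is $\alpha>0$ with $a(v,v,v)\ge\alpha\|v\|_X^2$ for all $v\in X$; and whenever $v_m\rightharpoonup v$ weakly in $X$, $a(v_m,v_m,u)\to a(v,v,u)$ for all $u\in X$ and $\liminf_{m\to\infty}a(v_m,v_m,v_m)\ge a(v,v,v)$. Then for every $f\in X^*$ there exists a solution $v\in X$ to the variational inequality $$a(v,v,u-v)+J(u)-J(v)\ge\langle f,u-v\rangle\quad\forall u\in X$$ satisfying the estimate $$\|v\|_X\le\frac1\alpha\|f\|_{X^*}.$$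
   Context: $\langle\cdot,\cdot\rangle$ is the duality pairing between $X^*$ and $X$. Weak continuity is sequential: $J$ is weakly continuous if $v_m\rightharpoonup v$ weakly in $X$ implies $J(v_m)\to J(v)$; $A_\varepsilon:X\to X^*$ is weakly continuous if $v_m\rightharpoonup v$ weakly in $X$ implies $\langle A_\varepsilon(v_m),u\rangle\to\langle A_\varepsilon(v),u\rangle$ for all $u\in X$. *)

theory Defs
  imports "HOL-Analysis.Analysis"
begin

text \<open>
  The dual space of \<open>'a\<close> is the type \<open>'a \<Rightarrow>\<^sub>L real\<close> of bounded linear functionals. Its norm is the
  operator norm, and the duality pairing is \<open>blinfun_apply\<close>.
\<close>

definition weakly_converges :: "(nat \<Rightarrow> 'a::real_normed_vector) \<Rightarrow> 'a \<Rightarrow> bool"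
    (infix "\<rightharpoonup>" 55)
  where "x \<rightharpoonup> l \<longleftrightarrow> (\<forall>\<phi>::'a \<Rightarrow>\<^sub>L real. (\<lambda>m. \<phi> (x m)) \<longlonglongrightarrow> \<phi> l)"

definition weakly_continuous_functional :: "('a::real_normed_vector \<Rightarrow> real) \<Rightarrow> bool"
  where "weakly_continuous_functional J \<longleftrightarrow>
    (\<forall>x l. x \<rightharpoonup> l \<longrightarrow> (\<lambda>m. J (x m)) \<longlonglongrightarrow> J l)"

text \<open>In the target space this is pointwise (weak-star) convergence.\<close>

definition weakly_continuous_operator ::
    "('a::real_normed_vector \<Rightarrow> ('a \<Rightarrow>\<^sub>L real)) \<Rightarrow> bool"
  where "weakly_continuous_operator A \<longleftrightarrow>
    (\<forall>x l. x \<rightharpoonup> l \<longrightarrow> (\<forall>u. (\<lambda>m. blinfun_apply (A (x m)) u) \<longlonglongrightarrow> blinfun_apply (A l) u))"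

definition has_gateaux_derivative ::
    "('a::real_normed_vector \<Rightarrow> real) \<Rightarrow> ('a \<Rightarrow>\<^sub>L real) \<Rightarrow> 'a \<Rightarrow> bool"
  where "has_gateaux_derivative J D v \<longleftrightarrow>
    (\<forall>u. ((\<lambda>t. (J (v + t *\<^sub>R u) - J v) / t) \<longlongrightarrow> blinfun_apply D u) (at (0::real)))"

end

theory Submission
  imports Defs "HOL-Homology.Homology"
begin

text \<open>
  For each test vector \<open>u\<close>, the vectors of the ball of radius \<open>\<parallel>f\<parallel> / \<alpha>\<close> that satisfy the inequality
  against \<open>u\<close> form a weakly sequentially closed set, hence a weakly compact one. So it suffices to
  treat finitely many \<open>u\<close> at a time, which is a Galerkin problem for \<open>J\<^sub>\<epsilon>\<close> on their span, solved by
  Brouwer's theorem, followed by a weak limit \<open>\<epsilon> \<rightarrow> 0\<close>. Passing to finite sets of test vectors, rather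
  than to a dense sequence of them, is essential: \<open>a v v\<close> is linear but not assumed bounded, so the
  inequality cannot be extended from a dense set of \<open>u\<close> by continuity.
\<close>

section \<open>Zeros of outward-pointing fields, from non-contractibility of the sphere\<close>

lemma nsphere_eq_top_of_set:
  "nsphere p = top_of_set {x. (\<Sum>i\<le>p. (x i)\<^sup>2) = 1 \<and> (\<forall>i>p. x i = 0)}"
  by (simp add: nsphere euclidean_product_topology)

text \<open>A family of fields without zeros on the sphere becomes a homotopy of self-maps once each
  value is divided by its Euclidean length. Coordinates above \<open>p\<close> are set to 0 because
  the points of \<open>nsphere p\<close> are sequences that vanish there.\<close>

lemma homotopic_nsphere_normalize:
  fixes h :: "nat \<Rightarrow> real \<times> (nat \<Rightarrow> real) \<Rightarrow> real"
  assumes cont: "\<And>i. i \<le> p \<Longrightarrow> continuous_on UNIV (h i)"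
    and nz: "\<And>t x. \<lbrakk>t \<in> {0..1}; x \<in> topspace (nsphere p)\<rbrakk> \<Longrightarrow> (\<Sum>i\<le>p. (h i (t, x))\<^sup>2) \<noteq> 0"
  defines "k \<equiv> \<lambda>tx i. if i \<le> p then h i tx / sqrt (\<Sum>j\<le>p. (h j tx)\<^sup>2) else 0"
  shows "homotopic_with (\<lambda>_. True) (nsphere p) (nsphere p) (\<lambda>x. k (0, x)) (\<lambda>x. k (1, x))"
proof -
  define S where "S = {x :: nat \<Rightarrow> real. (\<Sum>i\<le>p. (x i)\<^sup>2) = 1 \<and> (\<forall>i>p. x i = 0)}"
  have nsphere: "nsphere p = top_of_set S"
    unfolding S_def by (rule nsphere_eq_top_of_set)
  let ?s = "\<lambda>tx. \<Sum>j\<le>p. (h j tx)\<^sup>2"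
  have nz': "?s tx > 0" if "tx \<in> {0..1} \<times> S" for tx
  proof -
    have "?s tx \<noteq> 0"
      using nz[of "fst tx" "snd tx"] that by (auto simp: nsphere)
    moreover have "?s tx \<ge> 0" by (intro sum_nonneg) auto
    ultimately show ?thesis by linarith
  qed
  have cont': "continuous_on ({0..1} \<times> S) (h i)" if "i \<le> p" for i
    using cont[OF that] continuous_on_subset by blast
  have "continuous_on ({0..1} \<times> S) k"
  proof (rule continuous_on_coordinatewise_then_product)
    fix i
    show "continuous_on ({0..1} \<times> S) (\<lambda>tx. k tx i)"
    proof (cases "i \<le> p")
      case True
      have "continuous_on ({0..1} \<times> S) (\<lambda>tx. h i tx / sqrt (?s tx))"
        using nz' by (intro continuous_intros cont' True) force+
      then show ?thesis using True by (simp add: k_def)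
    qed (simp add: k_def)
  qed
  moreover have "k tx \<in> S" if "tx \<in> {0..1} \<times> S" for tx
  proof -
    have "(\<Sum>i\<le>p. (k tx i)\<^sup>2) = (\<Sum>i\<le>p. (h i tx)\<^sup>2 / ?s tx)"
      using nz'[OF that] by (intro sum.cong) (auto simp: k_def power_divide)
    also have "\<dots> = 1"
      using nz'[OF that] by (simp flip: sum_divide_distrib)
    finally show ?thesis by (simp add: S_def k_def)
  qed
  ultimately have "continuous_map (prod_topology (top_of_set {0..1}) (nsphere p)) (nsphere p) k"
    unfolding nsphere by (auto simp flip: subtopology_Times)
  then show ?thesis unfolding homotopic_with_def by blast
qed

text \<open>Without a zero, \<open>x \<mapsto> g x / |g x|\<close> on the sphere would be homotopic to the identity (along
  segments) and to a constant (along radii).\<close>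

theorem outward_field_has_zero:
  fixes g :: "nat \<Rightarrow> (nat \<Rightarrow> real) \<Rightarrow> real"
  assumes cont: "\<And>i. i \<le> p \<Longrightarrow> continuous_on UNIV (g i)"
    and "\<rho> > 0"
    and outward: "\<And>x. (\<Sum>i\<le>p. (x i)\<^sup>2) = \<rho>\<^sup>2 \<Longrightarrow> (\<Sum>i\<le>p. x i * g i x) > 0"
  obtains x where "\<And>i. i \<le> p \<Longrightarrow> g i x = 0"
proof (rule ccontr)
  assume "\<not> thesis"
  then have nz: "\<exists>i\<le>p. g i x \<noteq> 0" for x using that by blast
  let ?scale = "\<lambda>t x j. \<rho> * t * (x j :: real)"
  have contg: "continuous_on UNIV (\<lambda>tx. g i (?scale (f tx) (snd tx)))"
    if "i \<le> p" "continuous_on UNIV f" for i and f :: "real \<times> (nat \<Rightarrow> real) \<Rightarrow> real"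
  proof (rule continuous_on_compose2[OF cont[OF that(1)]])
    have c: "continuous_on UNIV (\<lambda>tx :: real \<times> (nat \<Rightarrow> real). snd tx j)" for j
      by (rule continuous_on_product_then_coordinatewise) (intro continuous_intros)
    show "continuous_on UNIV (\<lambda>tx. ?scale (f tx) (snd tx))"
      by (intro continuous_on_coordinatewise_then_product continuous_intros that c)
  qed simp
  \<comment> \<open>\<open>h\<^sub>1\<close> moves from the identity to \<open>g\<close> on the
    sphere of radius \<open>\<rho>\<close>; \<open>h\<^sub>2\<close> starts there and shrinks the
    radius to 0.\<close>
  define h\<^sub>1 where "h\<^sub>1 i tx = (1 - fst tx) * snd tx i + fst tx * g i (?scale 1 (snd tx))"
    for i and tx :: "real \<times> (nat \<Rightarrow> real)"
  define h\<^sub>2 where "h\<^sub>2 i tx = g i (?scale (1 - fst tx) (snd tx))"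
    for i and tx :: "real \<times> (nat \<Rightarrow> real)"
  let ?normalize = "\<lambda>h t x i. if i \<le> p then h i (t, x) / sqrt (\<Sum>j\<le>p. (h j (t, x))\<^sup>2) else 0"
  have hom1: "homotopic_with (\<lambda>_. True) (nsphere p) (nsphere p) (?normalize h\<^sub>1 0) (?normalize h\<^sub>1 1)"
  proof (rule homotopic_nsphere_normalize)
    fix i assume i: "i \<le> p"
    have "continuous_on UNIV (\<lambda>tx :: real \<times> (nat \<Rightarrow> real). snd tx i)"
      by (rule continuous_on_product_then_coordinatewise) (intro continuous_intros)
    then show "continuous_on UNIV (h\<^sub>1 i)"
      unfolding h\<^sub>1_def by (intro continuous_intros contg i)
  next
    fix t :: real and x assume t: "t \<in> {0..1}" and x: "x \<in> topspace (nsphere p)"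
    have x1: "(\<Sum>i\<le>p. (x i)\<^sup>2) = 1" using x by (simp add: nsphere_eq_top_of_set)
    have "(\<Sum>i\<le>p. (\<rho> * x i)\<^sup>2) = \<rho>\<^sup>2"
      using x1 by (simp add: power_mult_distrib flip: sum_distrib_left)
    from outward[of "\<lambda>i. \<rho> * x i", OF this]
    have "0 < \<rho> * (\<Sum>i\<le>p. x i * g i (?scale 1 x))"
      by (simp add: sum_distrib_left mult.assoc)
    then have pos: "0 < (\<Sum>i\<le>p. x i * g i (?scale 1 x))"
      using \<open>\<rho> > 0\<close> by (simp add: zero_less_mult_iff)
    \<comment> \<open>The inner product with \<open>x\<close> stays positive along the whole
      segment, so the segment avoids the origin.\<close>
    have "(\<Sum>i\<le>p. x i * h\<^sub>1 i (t, x)) =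
        (1 - t) * (\<Sum>i\<le>p. (x i)\<^sup>2) + t * (\<Sum>i\<le>p. x i * g i (?scale 1 x))"
      by (simp add: h\<^sub>1_def sum_distrib_left algebra_simps power2_eq_square flip: sum.distrib)
    also have "\<dots> > 0"
    proof (cases "t = 0")
      case False
      then have "t * (\<Sum>i\<le>p. x i * g i (?scale 1 x)) > 0" using t pos by simp
      then show ?thesis using t x1 by simp
    qed (simp add: x1)
    finally have "\<exists>i\<le>p. h\<^sub>1 i (t, x) \<noteq> 0"
      by (metis (no_types, lifting) atMost_iff less_irrefl mult_zero_right sum.neutral)
    then show "(\<Sum>i\<le>p. (h\<^sub>1 i (t, x))\<^sup>2) \<noteq> 0"
      by (auto simp: sum_nonneg_eq_0_iff)
  qed
  have hom2: "homotopic_with (\<lambda>_. True) (nsphere p) (nsphere p) (?normalize h\<^sub>2 0) (?normalize h\<^sub>2 1)"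
  proof (rule homotopic_nsphere_normalize)
    show "continuous_on UNIV (h\<^sub>2 i)" if "i \<le> p" for i
      unfolding h\<^sub>2_def by (intro contg that continuous_intros)
    show "(\<Sum>i\<le>p. (h\<^sub>2 i (t, x))\<^sup>2) \<noteq> 0" for t x
      using nz by (auto simp: sum_nonneg_eq_0_iff h\<^sub>2_def)
  qed
  have "?normalize h\<^sub>1 1 = ?normalize h\<^sub>2 0" by (intro ext) (auto simp: h\<^sub>1_def h\<^sub>2_def)
  then have "homotopic_with (\<lambda>_. True) (nsphere p) (nsphere p) (?normalize h\<^sub>1 0) (?normalize h\<^sub>2 1)"
    using homotopic_with_trans[OF hom1] hom2 by simp
  moreover have "?normalize h\<^sub>1 0 x = id x" if "x \<in> topspace (nsphere p)" for x
    using that by (auto simp: h\<^sub>1_def nsphere_eq_top_of_set)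
  \<comment> \<open>At time 1 the scaling factor is 0, so \<open>g\<close> is evaluated at the
    origin only and the map is constant.\<close>
  moreover have "?normalize h\<^sub>2 1 (\<lambda>_. 0) = ?normalize h\<^sub>2 1 x" for x
    by (intro ext) (auto simp: h\<^sub>2_def)
  ultimately have "homotopic_with (\<lambda>_. True) (nsphere p) (nsphere p) id (\<lambda>_. ?normalize h\<^sub>2 1 (\<lambda>_. 0))"
    by (elim homotopic_with_eq) (simp_all only: simp_thms)
  then have "contractible_space (nsphere p)"
    unfolding contractible_space_def by blast
  then show False using non_contractible_space_nsphere by blast
qed

section \<open>Riesz representation and weak sequential compactness\<close>

lemma tendsto_fun_iff_coordinatewise:
  fixes l :: "'i \<Rightarrow> 'b::topological_space"
  shows "(x \<longlongrightarrow> l) F \<longleftrightarrow> (\<forall>i. ((\<lambda>n. x n i) \<longlongrightarrow> l i) F)"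
  by (simp add: limitin_componentwise flip: limitin_canonical_iff euclidean_product_topology)

text \<open>The representing vector is the minimiser of the quadratic functional \<open>q\<close>:
  the parallelogram law makes minimising sequences Cauchy, and the vanishing first variation at the
  limit is the required identity.\<close>

lemma riesz_representation:
  fixes \<phi> :: "'a::{real_inner, complete_space} \<Rightarrow>\<^sub>L real"
  obtains y where "\<And>x. blinfun_apply \<phi> x = y \<bullet> x"
proof -
  define q where "q x = (norm x)\<^sup>2 - 2 * \<phi> x" for x
  define m where "m = Inf (range q)"
  have "- (norm \<phi>)\<^sup>2 \<le> q x" for x
  proof -
    have "\<phi> x \<le> norm \<phi> * norm x" using norm_blinfun[of \<phi> x] by simp
    moreover have "0 \<le> (norm x - norm \<phi>)\<^sup>2" by simp
    ultimately show ?thesis unfolding q_def power2_diff by (simp add: algebra_simps)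
  qed
  then have bdd: "bdd_below (range q)" by (intro bdd_belowI2)
  then have m_le: "m \<le> q x" for x unfolding m_def by (simp add: cINF_lower)
  have "\<exists>x. q x < m + inverse (real (Suc n))" for n
    using cInf_lessD[of "range q" "m + inverse (real (Suc n))"] by (auto simp: m_def)
  then obtain x where x: "\<And>n. q (x n) < m + inverse (real (Suc n))" by metis
  \<comment> \<open>Parallelogram law: the linear parts of \<open>q\<close> cancel, and
    \<open>q\<close> at the midpoint is at least \<open>m\<close>.\<close>
  have par: "(norm (u - v))\<^sup>2 \<le> 2 * (q u - m) + 2 * (q v - m)" for u v
  proof -
    have "(norm (u - v))\<^sup>2 = 2 * q u + 2 * q v - 4 * q ((1/2) *\<^sub>R (u + v))"
      by (simp add: q_def power2_norm_eq_inner inner_diff inner_add inner_commute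
          blinfun.scaleR_right blinfun.add_right field_simps)
    then show ?thesis using m_le[of "(1/2) *\<^sub>R (u + v)"] by simp
  qed
  have "Cauchy x"
  proof (rule metric_CauchyI)
    fix e :: real assume "e > 0"
    then obtain N where N: "inverse (real (Suc N)) < e\<^sup>2 / 4"
      using reals_Archimedean[of "e\<^sup>2 / 4"] by auto
    have small: "q (x n) - m < e\<^sup>2 / 4" if "n \<ge> N" for n
    proof -
      have "inverse (real (Suc n)) \<le> inverse (real (Suc N))" using that by simp
      then show ?thesis using x[of n] N by linarith
    qed
    have "dist (x i) (x j) < e" if "i \<ge> N" "j \<ge> N" for i j
    proof -
      have "(norm (x i - x j))\<^sup>2 < e\<^sup>2"
        using par[of "x i" "x j"] small[OF that(1)] small[OF that(2)] by simp
      then show ?thesis using \<open>e > 0\<close> by (simp add: dist_norm power_less_imp_less_base)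
    qed
    then show "\<exists>M. \<forall>i\<ge>M. \<forall>j\<ge>M. dist (x i) (x j) < e" by blast
  qed
  then obtain y where y: "x \<longlonglongrightarrow> y" using Cauchy_convergent convergent_def by blast
  have "(\<lambda>n. q (x n)) \<longlonglongrightarrow> q y"
    unfolding q_def by (intro tendsto_intros y)
  moreover have "(\<lambda>n. m + inverse (real (Suc n))) \<longlonglongrightarrow> m + 0"
    by (intro tendsto_intros LIMSEQ_inverse_real_of_nat)
  ultimately have "q y \<le> m + 0"
    using x by (intro LIMSEQ_le) (auto intro: less_imp_le)
  then have min: "q y \<le> q z" for z using m_le[of z] by simp
  have "\<phi> u = y \<bullet> u" for u
  proof -
    define c where "c = y \<bullet> u - \<phi> u"
    have quad: "0 \<le> t\<^sup>2 * (norm u)\<^sup>2 + 2 * t * c" for t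
      using min[of "y + t *\<^sub>R u"]
      by (simp add: q_def c_def power2_norm_eq_inner inner_add inner_commute power2_eq_square[of t]
          blinfun.scaleR_right blinfun.add_right algebra_simps)
    have "c = 0"
    proof (rule ccontr)
      assume "c \<noteq> 0"
      \<comment> \<open>The quadratic in \<open>t\<close> is tested near its minimum, at
        \<open>t = - c / s\<close>. The summand 1 keeps \<open>s\<close> positive when
        \<open>u = 0\<close>.\<close>
      define s where "s = (norm u)\<^sup>2 + 1"
      have s: "s > 0" by (simp add: s_def add_nonneg_pos)
      have "0 \<le> (c / s)\<^sup>2 * (norm u)\<^sup>2 - 2 * c\<^sup>2 / s"
        using quad[of "- c / s"] by (simp add: power2_eq_square)
      also have "\<dots> \<le> (c / s)\<^sup>2 * s - 2 * c\<^sup>2 / s"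
        by (simp add: s_def mult_left_mono)
      also have "\<dots> = - (c\<^sup>2 / s)" using s by (simp add: power2_eq_square field_simps)
      also have "\<dots> < 0" using s \<open>c \<noteq> 0\<close> by simp
      finally show False by simp
    qed
    then show ?thesis by (simp add: c_def)
  qed
  then show ?thesis using that by blast
qed

lemma weakly_converges_iff_inner:
  fixes l :: "'a::{real_inner, complete_space}"
  shows "x \<rightharpoonup> l \<longleftrightarrow> (\<forall>u. (\<lambda>n. u \<bullet> x n) \<longlonglongrightarrow> u \<bullet> l)"
proof
  assume x: "x \<rightharpoonup> l"
  show "\<forall>u. (\<lambda>n. u \<bullet> x n) \<longlonglongrightarrow> u \<bullet> l"
  proof
    fix u :: 'a
    have "blinfun_apply (Blinfun ((\<bullet>) u)) = (\<bullet>) u"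
      by (simp add: bounded_linear_Blinfun_apply bounded_linear_inner_right)
    then show "(\<lambda>n. u \<bullet> x n) \<longlonglongrightarrow> u \<bullet> l"
      using x unfolding weakly_converges_def by metis
  qed
next
  assume "\<forall>u. (\<lambda>n. u \<bullet> x n) \<longlonglongrightarrow> u \<bullet> l"
  then show "x \<rightharpoonup> l"
    unfolding weakly_converges_def by (metis (no_types, lifting) riesz_representation ext)
qed

lemma tendsto_imp_weakly_converges:
  assumes "x \<longlonglongrightarrow> l"
  shows "x \<rightharpoonup> l"
  unfolding weakly_converges_def by (intro allI tendsto_intros assms)

text \<open>Testing the weak convergence against \<open>l\<close> itself bounds
  \<open>l \<bullet> l\<close> by \<open>norm l * R\<close>.\<close>

lemma weak_limit_norm_le:
  fixes l :: "'a::{real_inner, complete_space}"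
  assumes "x \<rightharpoonup> l" "\<And>n. norm (x n) \<le> R"
  shows "norm l \<le> R"
proof (cases "l = 0")
  case False
  have "l \<bullet> x n \<le> norm l * R" for n
    using norm_cauchy_schwarz[of l "x n"] mult_left_mono[OF assms(2)[of n] norm_ge_zero[of l]]
    by linarith
  moreover have "(\<lambda>n. l \<bullet> x n) \<longlonglongrightarrow> l \<bullet> l"
    using assms(1) by (simp add: weakly_converges_iff_inner)
  ultimately have "l \<bullet> l \<le> norm l * R" by (intro LIMSEQ_le_const2) auto
  then have "norm l * norm l \<le> norm l * R"
    by (simp flip: power2_norm_eq_inner power2_eq_square)
  then show ?thesis using False by simp
qed (use order_trans[OF norm_ge_zero assms(2)] in simp)

lemma separable_imp_dense_sequence:
  assumes "separable_space (euclidean :: 'a::metric_space topology)"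
  obtains d :: "nat \<Rightarrow> 'a::metric_space" where "\<And>u e. e > 0 \<Longrightarrow> \<exists>n. dist (d n) u < e"
proof -
  obtain C :: "'a set" where C: "countable C" "closure C = UNIV"
    using assms by (auto simp: separable_space_def)
  then have "C \<noteq> {}" by auto
  then have "range (from_nat_into C) = C" using C(1) by (rule range_from_nat_into)
  then have "\<exists>n. dist (from_nat_into C n) u < e" if "e > 0" for u e
    using C(2) that closure_approachable[of u C] by (metis UNIV_I rangeE)
  then show ?thesis using that by blast
qed

text \<open>Inner products with a dense sequence put the \<open>x k\<close> into a countable product
  of compact intervals, which is sequentially compact. Boundedness extends the convergence from the
  dense sequence to every \<open>u\<close>, and the limit functional is represented by some
  \<open>l\<close>.\<close>

lemma weakly_convergent_subsequence:
  fixes x :: "nat \<Rightarrow> 'a::{real_inner, complete_space}"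
  assumes "separable_space (euclidean :: 'a topology)"
    and bounded: "\<And>n. norm (x n) \<le> R"
  obtains r l where "strict_mono (r :: nat \<Rightarrow> nat)" "(x \<circ> r) \<rightharpoonup> l" "norm l \<le> R"
proof -
  obtain d :: "nat \<Rightarrow> 'a" where d: "\<And>u e. e > 0 \<Longrightarrow> \<exists>n. dist (d n) u < e"
    using separable_imp_dense_sequence[OF assms(1)] by blast
  have R: "R \<ge> 0" using bounded[of 0] norm_ge_zero order_trans by blast
  define B where "B = Pi\<^sub>E UNIV (\<lambda>n. {- (norm (d n) * R)..norm (d n) * R})"
  \<comment> \<open>Tychonoff's theorem, carried from the abstract product topology to the type
    \<open>nat \<Rightarrow> real\<close>.\<close>
  have "compact B"
    unfolding B_def
    by (simp only: compactin_PiE compactin_euclidean_iff compact_Icc simp_thms ball_simps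
        flip: euclidean_product_topology compactin_euclidean_iff[where 'a = "nat \<Rightarrow> real"])
  moreover have "(\<lambda>n. d n \<bullet> x k) \<in> B" for k
  proof -
    have "\<bar>d n \<bullet> x k\<bar> \<le> norm (d n) * R" for n
      using Cauchy_Schwarz_ineq2[of "d n" "x k"] mult_left_mono[OF bounded[of k] norm_ge_zero[of "d n"]]
      by linarith
    then show ?thesis by (auto simp: B_def abs_le_iff minus_le_iff)
  qed
  ultimately obtain g r where r: "strict_mono (r :: nat \<Rightarrow> nat)"
    and g: "((\<lambda>k n. d n \<bullet> x k) \<circ> r) \<longlonglongrightarrow> g"
    unfolding compact_eq_seq_compact_metric seq_compact_def by metis
  have g_lim: "(\<lambda>k. d n \<bullet> x (r k)) \<longlonglongrightarrow> g n" for n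
    using g by (simp add: tendsto_fun_iff_coordinatewise)
  have "convergent (\<lambda>k. u \<bullet> x (r k))" for u
  proof (rule Cauchy_convergent, rule metric_CauchyI)
    fix e :: real assume e: "e > 0"
    \<comment> \<open>Two replacements of \<open>u\<close> by \<open>d n\<close> and one Cauchy
      estimate cost \<open>e / 3\<close> each; \<open>R + 1\<close> avoids a zero
      denominator.\<close>
    define \<delta> where "\<delta> = e / (3 * (R + 1))"
    have "\<delta> > 0" using e R by (simp add: \<delta>_def)
    then obtain n where n: "dist (d n) u < \<delta>" using d by blast
    have close: "\<bar>u \<bullet> x k - d n \<bullet> x k\<bar> \<le> e / 3" for k
    proof -
      have "\<bar>u \<bullet> x k - d n \<bullet> x k\<bar> \<le> norm (u - d n) * norm (x k)"
        using Cauchy_Schwarz_ineq2[of "u - d n" "x k"] by (simp add: inner_diff_left)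
      also have "\<dots> \<le> \<delta> * (R + 1)"
        using n bounded[of k] R \<open>\<delta> > 0\<close>
        by (intro mult_mono) (auto simp: dist_norm norm_minus_commute)
      also have "\<dots> = e / 3" using R by (simp add: \<delta>_def field_simps)
      finally show ?thesis .
    qed
    have "Cauchy (\<lambda>k. d n \<bullet> x (r k))" using g_lim by (rule LIMSEQ_imp_Cauchy)
    then obtain N where N: "\<And>i j. i \<ge> N \<Longrightarrow> j \<ge> N \<Longrightarrow> dist (d n \<bullet> x (r i)) (d n \<bullet> x (r j)) < e / 3"
      using e by (metis metric_CauchyD zero_less_divide_iff zero_less_numeral)
    have "dist (u \<bullet> x (r i)) (u \<bullet> x (r j)) < e" if "i \<ge> N" "j \<ge> N" for i j
      using N[OF that] close[of "r i"] close[of "r j"] unfolding dist_real_def by linarith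
    then show "\<exists>M. \<forall>i\<ge>M. \<forall>j\<ge>M. dist (u \<bullet> x (r i)) (u \<bullet> x (r j)) < e" by blast
  qed
  then obtain L where L: "\<And>u. (\<lambda>k. u \<bullet> x (r k)) \<longlonglongrightarrow> L u"
    unfolding convergent_def by metis
  have L_le: "\<bar>L u\<bar> \<le> norm u * R" for u
  proof (rule LIMSEQ_le_const2[OF tendsto_rabs[OF L]])
    have "\<bar>u \<bullet> x (r n)\<bar> \<le> norm u * R" for n
      using Cauchy_Schwarz_ineq2[of u "x (r n)"]
        mult_left_mono[OF bounded[of "r n"] norm_ge_zero[of u]] by linarith
    then show "\<exists>N. \<forall>n\<ge>N. \<bar>u \<bullet> x (r n)\<bar> \<le> norm u * R" by blast
  qed
  have "bounded_linear L"
  proof (rule bounded_linear_intro)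
    show "L (u + v) = L u + L v" for u v
      by (rule LIMSEQ_unique[OF L])
        (use tendsto_add[OF L L] in \<open>simp add: inner_add_left\<close>)
    show "L (c *\<^sub>R u) = c *\<^sub>R L u" for c u
      by (rule LIMSEQ_unique[OF L])
        (use tendsto_mult_left[OF L] in simp)
    show "norm (L u) \<le> norm u * R" for u using L_le by simp
  qed
  then obtain l where l: "\<And>u. L u = l \<bullet> u"
    using riesz_representation[of "Blinfun L"] by (auto simp: bounded_linear_Blinfun_apply)
  have "(x \<circ> r) \<rightharpoonup> l"
    using L by (simp add: weakly_converges_iff_inner l inner_commute)
  moreover have "norm l \<le> R"
    using weak_limit_norm_le[OF calculation] bounded by simp
  ultimately show ?thesis using r that by blast
qed

section \<open>Finite intersection property for the weak topology\<close>

text \<open>The map \<open>\<Phi>\<close> into the metrizable space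
  \<open>nat \<Rightarrow> real\<close> is injective and sends weak convergence to coordinatewise
  convergence. The images of the \<open>C i\<close> are therefore compact there, and injectivity
  pulls a common image point back to a common point.\<close>

lemma weakly_seq_closed_fip:
  fixes C :: "'i \<Rightarrow> 'a::{real_inner, complete_space} set"
  assumes sep: "separable_space (euclidean :: 'a topology)"
    and bounded: "\<And>i v. v \<in> C i \<Longrightarrow> norm v \<le> R"
    and closed: "\<And>i x l. \<lbrakk>\<And>n. x n \<in> C i; x \<rightharpoonup> l\<rbrakk> \<Longrightarrow> l \<in> C i"
    and fip: "\<And>F. finite F \<Longrightarrow> (\<Inter>i\<in>F. C i) \<noteq> {}"
  shows "(\<Inter>i. C i) \<noteq> {}"
proof -
  obtain d :: "nat \<Rightarrow> 'a" where d: "\<And>u e. e > 0 \<Longrightarrow> \<exists>n. dist (d n) u < e"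
    using separable_imp_dense_sequence[OF sep] by blast
  define \<Phi> where "\<Phi> v n = d n \<bullet> v" for v n
  have inj: "v = w" if "\<Phi> v = \<Phi> w" for v w
  proof (rule ccontr)
    assume "v \<noteq> w"
    \<comment> \<open>A vector closer to \<open>v - w\<close> than the length of
      \<open>v - w\<close> cannot be orthogonal to it.\<close>
    then obtain n where n: "norm (d n - (v - w)) < norm (v - w)"
      using d[of "norm (v - w)" "v - w"] by (auto simp: dist_norm)
    have "d n \<bullet> (v - w) = 0"
      using fun_cong[OF that, of n] by (simp add: \<Phi>_def inner_diff_right)
    then have "(norm (v - w))\<^sup>2 = (v - w - d n) \<bullet> (v - w)"
      by (simp add: inner_diff_left power2_norm_eq_inner)
    also have "\<dots> \<le> norm (v - w - d n) * norm (v - w)" by (rule norm_cauchy_schwarz)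
    also have "\<dots> < norm (v - w) * norm (v - w)"
      using n \<open>v \<noteq> w\<close> by (intro mult_strict_right_mono) (auto simp: norm_minus_commute)
    finally show False by (simp add: power2_eq_square)
  qed
  have compact: "compact (\<Phi> ` C i)" for i
    unfolding compact_eq_seq_compact_metric seq_compact_def
  proof (intro allI impI)
    fix y :: "nat \<Rightarrow> nat \<Rightarrow> real" assume "\<forall>n. y n \<in> \<Phi> ` C i"
    then have "\<forall>n. \<exists>v. v \<in> C i \<and> y n = \<Phi> v" by blast
    then obtain x where x: "\<And>n. x n \<in> C i" "\<And>n. y n = \<Phi> (x n)" by metis
    obtain r l where r: "strict_mono (r :: nat \<Rightarrow> nat)" and l: "(x \<circ> r) \<rightharpoonup> l"
      using weakly_convergent_subsequence[OF sep, of x R] bounded[OF x(1)] by blast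
    have "l \<in> C i" using closed[OF _ l] x(1) by simp
    moreover have "(y \<circ> r) \<longlonglongrightarrow> \<Phi> l"
      using l by (simp add: tendsto_fun_iff_coordinatewise weakly_converges_iff_inner x(2) \<Phi>_def o_def)
    ultimately show "\<exists>l\<in>\<Phi> ` C i. \<exists>r. strict_mono r \<and> (y \<circ> r) \<longlonglongrightarrow> l"
      using r by blast
  qed
  \<comment> \<open>An arbitrary index supplies the compact set inside which the closed sets are
    intersected.\<close>
  fix i\<^sub>0 :: 'i
  have "\<Phi> ` C i\<^sub>0 \<inter> \<Inter> (range (\<lambda>i. \<Phi> ` C i)) \<noteq> {}"
  proof (rule compact_imp_fip[OF compact])
    show "closed T" if "T \<in> range (\<lambda>i. \<Phi> ` C i)" for T
      using that compact compact_imp_closed by auto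
    show "\<Phi> ` C i\<^sub>0 \<inter> \<Inter> \<F> \<noteq> {}" if \<F>: "finite \<F>" "\<F> \<subseteq> range (\<lambda>i. \<Phi> ` C i)" for \<F>
    proof -
      obtain F where F: "finite F" "\<F> = (\<lambda>i. \<Phi> ` C i) ` F"
        using finite_subset_image[OF \<F>] by blast
      obtain v where "v \<in> (\<Inter>i\<in>insert i\<^sub>0 F. C i)" using fip[of "insert i\<^sub>0 F"] F(1) by blast
      then have "\<Phi> v \<in> \<Phi> ` C i\<^sub>0 \<inter> \<Inter> \<F>" by (auto simp: F(2))
      then show ?thesis by blast
    qed
  qed
  then obtain v where "\<And>i. \<Phi> v \<in> \<Phi> ` C i" by blast
  then have "v \<in> C i" for i using inj by (metis imageE)
  then show ?thesis by blast
qed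

section \<open>Galerkin approximation in a finite-dimensional span\<close>

text \<open>By convexity the difference quotients from \<open>v\<close> towards \<open>u\<close> are
  at most \<open>j u - j v\<close> for \<open>0 < t < 1\<close>; the bound survives \<open>t\<close>
  tending to 0 from the right.\<close>

lemma convex_gateaux_above_tangent:
  fixes j :: "'a::real_normed_vector \<Rightarrow> real"
  assumes "convex_on UNIV j" "has_gateaux_derivative j D v"
  shows "j u - j v \<ge> blinfun_apply D (u - v)"
proof (rule tendsto_upperbound)
  show "((\<lambda>t. (j (v + t *\<^sub>R (u - v)) - j v) / t) \<longlongrightarrow> D (u - v)) (at_right 0)"
    using assms(2) unfolding has_gateaux_derivative_def
    by (blast intro: tendsto_within_subset)
  have "(j (v + t *\<^sub>R (u - v)) - j v) / t \<le> j u - j v" if "t \<in> {0<..<1}" for t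
  proof -
    have "j ((1 - t) *\<^sub>R v + t *\<^sub>R u) \<le> (1 - t) * j v + t * j u"
      using assms(1) that by (intro convex_onD) auto
    then have "j (v + t *\<^sub>R (u - v)) - j v \<le> t * (j u - j v)"
      by (simp add: algebra_simps)
    then show ?thesis using that by (simp add: divide_le_eq mult.commute)
  qed
  then show "\<forall>\<^sub>F t in at_right 0. (j (v + t *\<^sub>R (u - v)) - j v) / t \<le> j u - j v"
    using eventually_at_right_real[of 0 1] by (auto elim: eventually_mono)
qed simp

text \<open>A zero of the perturbed Galerkin field satisfies the equation tested with each
  \<open>b i\<close> up to \<open>\<delta> * x i\<close>. Subtracting the equation tested with
  \<open>v\<close>, and replacing \<open>A v\<close> by differences of \<open>j\<close> through
  convexity, gives the inequality with error \<open>e\<close>.\<close>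

lemma galerkin_approximation:
  fixes j :: "'a::{real_inner, complete_space} \<Rightarrow> real"
    and A :: "'a \<Rightarrow> ('a \<Rightarrow>\<^sub>L real)"
    and a :: "'a \<Rightarrow> 'a \<Rightarrow> 'a \<Rightarrow> real"
    and f :: "'a \<Rightarrow>\<^sub>L real"
    and b :: "nat \<Rightarrow> 'a"
  assumes j_convex: "convex_on UNIV j"
    and j_deriv: "\<And>v. has_gateaux_derivative j (A v) v"
    and A_weak: "weakly_continuous_operator A"
    and A_zero: "A 0 = 0"
    and a_bilinear: "\<And>w. bilinear (a w)"
    and "\<alpha> > 0"
    and a_coercive: "\<And>v. a v v v \<ge> \<alpha> * (norm v)\<^sup>2"
    and a_weak: "\<And>x v u. x \<rightharpoonup> v \<Longrightarrow> (\<lambda>m. a (x m) (x m) u) \<longlonglongrightarrow> a v v u"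
    and "e > 0"
  obtains v where "norm v \<le> norm f / \<alpha>"
    "\<And>i. i \<le> p \<Longrightarrow> a v v (b i - v) + j (b i) - j v \<ge> blinfun_apply f (b i - v) - e"
proof -
  \<comment> \<open>Chosen so that \<open>\<delta> * (norm f)\<^sup>2 / \<alpha>\<close> is at most
    \<open>e\<^sup>2\<close>, which later bounds \<open>\<delta> * x i\<close> by \<open>e\<close>.
    The 1 covers \<open>f = 0\<close>.\<close>
  define \<delta> where "\<delta> = e\<^sup>2 * \<alpha> / ((norm f)\<^sup>2 + 1)"
  have "\<delta> > 0" using \<open>e > 0\<close> \<open>\<alpha> > 0\<close> by (simp add: \<delta>_def add_nonneg_pos)
  have "\<delta> * (norm f)\<^sup>2 / \<alpha> = e\<^sup>2 * ((norm f)\<^sup>2 / ((norm f)\<^sup>2 + 1))"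
    using \<open>\<alpha> > 0\<close> by (simp add: \<delta>_def)
  also have "\<dots> \<le> e\<^sup>2 * 1"
    by (intro mult_left_mono) (simp_all add: divide_le_eq add_nonneg_pos)
  finally have \<delta>_le: "\<delta> * ((norm f)\<^sup>2 / \<alpha>) \<le> e\<^sup>2" by simp
  have lin: "linear (a w u)" for w u
    using a_bilinear[of w] by (simp add: bilinear_def)
  \<comment> \<open>The tangent inequalities at 0 and at \<open>v\<close> are added: monotonicity of
    \<open>A\<close> together with \<open>A 0 = 0\<close>.\<close>
  have A_nonneg: "A v v \<ge> 0" for v
    using convex_gateaux_above_tangent[OF j_convex j_deriv, of 0 v]
      convex_gateaux_above_tangent[OF j_convex j_deriv, of v 0]
    by (simp add: A_zero blinfun.minus_right)
  have f_le: "f v \<le> norm f * norm v" for v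
    using norm_blinfun[of f v] by simp
  define E where "E x = (\<Sum>i\<le>p. x i *\<^sub>R b i)" for x
  txt \<open>The term \<open>\<delta> * x i\<close> makes \<open>g\<close> point outwards on large spheres even if the \<open>b i\<close> are linearly
    dependent.\<close>
  define g where "g i x = a (E x) (E x) (b i) + A (E x) (b i) - f (b i) + \<delta> * x i" for i x
  \<comment> \<open>On the finite-dimensional span, convergence of the coefficients gives norm
    convergence of \<open>E\<close>, hence weak convergence, to which the hypotheses on
    \<open>a\<close> and \<open>A\<close> apply.\<close>
  have cont: "continuous_on UNIV (g i)" for i
    unfolding continuous_on_sequentially
  proof (intro allI ballI impI, elim conjE)
    fix x :: "nat \<Rightarrow> nat \<Rightarrow> real" and l
    assume x: "x \<longlonglongrightarrow> l"
    have coord: "(\<lambda>n. x n i) \<longlonglongrightarrow> l i" for i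
      using x by (simp add: tendsto_fun_iff_coordinatewise)
    have "(\<lambda>n. E (x n)) \<longlonglongrightarrow> E l"
      unfolding E_def by (intro tendsto_intros coord)
    then have weak: "(\<lambda>n. E (x n)) \<rightharpoonup> E l" by (rule tendsto_imp_weakly_converges)
    have "(\<lambda>n. A (E (x n)) (b i)) \<longlonglongrightarrow> A (E l) (b i)"
      using A_weak weak unfolding weakly_continuous_operator_def by blast
    then show "(g i \<circ> x) \<longlonglongrightarrow> g i l"
      unfolding g_def o_def
      by (intro tendsto_add tendsto_diff tendsto_mult_left tendsto_const a_weak[OF weak] coord)
  qed
  have energy: "(\<Sum>i\<le>p. x i * g i x) =
      a (E x) (E x) (E x) + A (E x) (E x) - f (E x) + \<delta> * (\<Sum>i\<le>p. (x i)\<^sup>2)" for x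
  proof -
    have "a w w (E x) = (\<Sum>i\<le>p. x i * a w w (b i))" for w
      using lin[of w w] by (simp add: E_def linear_sum linear_cmul)
    moreover have "\<phi> (E x) = (\<Sum>i\<le>p. x i * \<phi> (b i))" for \<phi> :: "'a \<Rightarrow>\<^sub>L real"
      by (simp add: E_def blinfun.sum_right blinfun.scaleR_right)
    ultimately show ?thesis
      by (simp add: g_def sum.distrib sum_subtractf sum_distrib_left algebra_simps power2_eq_square)
  qed
  have energy_ge: "(\<Sum>i\<le>p. x i * g i x) \<ge>
      \<alpha> * (norm (E x))\<^sup>2 - norm f * norm (E x) + \<delta> * (\<Sum>i\<le>p. (x i)\<^sup>2)" for x
    using energy[of x] a_coercive[of "E x"] A_nonneg[of "E x"] f_le[of "E x"] by linarith
  \<comment> \<open>Completing the square; the constant is four times the sharp one.\<close>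
  have young: "\<alpha> * s\<^sup>2 - norm f * s \<ge> - ((norm f)\<^sup>2 / \<alpha>)" for s
  proof -
    have "0 \<le> (2 * \<alpha> * s - norm f)\<^sup>2 + 3 * (norm f)\<^sup>2" by simp
    also have "\<dots> = 4 * \<alpha> * (\<alpha> * s\<^sup>2 - norm f * s + (norm f)\<^sup>2 / \<alpha>)"
      using \<open>\<alpha> > 0\<close> by (simp add: power2_eq_square field_simps)
    finally show ?thesis using \<open>\<alpha> > 0\<close> by (simp add: zero_le_mult_iff)
  qed
  \<comment> \<open>On the sphere of radius \<open>\<rho>\<close> the perturbation exceeds the bound
    from \<open>young\<close> by exactly 1.\<close>
  define \<rho> where "\<rho> = sqrt (((norm f)\<^sup>2 / \<alpha> + 1) / \<delta>)"
  have \<rho>: "\<rho> > 0" "\<delta> * \<rho>\<^sup>2 = (norm f)\<^sup>2 / \<alpha> + 1"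
    using \<open>\<alpha> > 0\<close> \<open>\<delta> > 0\<close> by (simp_all add: \<rho>_def add_nonneg_pos)
  obtain x where x: "\<And>i. i \<le> p \<Longrightarrow> g i x = 0"
  proof (rule outward_field_has_zero[of p g \<rho>])
    show "(\<Sum>i\<le>p. x i * g i x) > 0" if "(\<Sum>i\<le>p. (x i)\<^sup>2) = \<rho>\<^sup>2" for x
      using energy_ge[of x] young[of "norm (E x)"] \<rho>(2) that by simp
  qed (use cont \<rho> in auto)
  define v where "v = E x"
  define N where "N = (\<Sum>i\<le>p. (x i)\<^sup>2)"
  have "N \<ge> 0" by (simp add: N_def sum_nonneg)
  have eq: "a v v v + A v v - f v + \<delta> * N = 0"
    using energy[of x] x by (simp add: v_def N_def)
  have le: "\<alpha> * (norm v)\<^sup>2 - norm f * norm v + \<delta> * N \<le> 0"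
    using energy_ge[of x] x by (simp add: v_def N_def)
  \<comment> \<open>Dropping the nonnegative term \<open>\<delta> * N\<close> from \<open>le\<close>
    gives a bound free of \<open>\<delta>\<close>.\<close>
  have norm_v: "norm v \<le> norm f / \<alpha>"
  proof (cases "v = 0")
    case False
    have "\<delta> * N \<ge> 0" using \<open>N \<ge> 0\<close> \<open>\<delta> > 0\<close> by simp
    then have "norm v * (\<alpha> * norm v) \<le> norm v * norm f"
      using le by (simp add: power2_eq_square algebra_simps)
    then show ?thesis using False \<open>\<alpha> > 0\<close> by (simp add: le_divide_eq mult.commute)
  qed (use \<open>\<alpha> > 0\<close> in simp)
  \<comment> \<open>Keeping that term instead controls the size of the perturbation.\<close>
  have "\<delta> * N \<le> (norm f)\<^sup>2 / \<alpha>" using le young[of "norm v"] by linarith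
  then have "\<delta> * (\<delta> * N) \<le> \<delta> * ((norm f)\<^sup>2 / \<alpha>)"
    using \<open>\<delta> > 0\<close> by (intro mult_left_mono) auto
  then have N_le: "\<delta>\<^sup>2 * N \<le> e\<^sup>2"
    using \<delta>_le by (simp add: power2_eq_square mult.assoc)
  \<comment> \<open>The \<open>i\<close>-th equation minus the energy identity \<open>eq\<close>
    leaves \<open>\<delta> * N - \<delta> * x i\<close>, which is at least
    \<open>- e\<close>.\<close>
  have "a v v (b i - v) + j (b i) - j v \<ge> f (b i - v) - e" if i: "i \<le> p" for i
  proof -
    have "(x i)\<^sup>2 \<le> N" unfolding N_def by (rule member_le_sum) (use i in auto)
    then have "(\<delta> * x i)\<^sup>2 \<le> \<delta>\<^sup>2 * N" by (simp add: power_mult_distrib mult_left_mono)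
    then have "(\<delta> * x i)\<^sup>2 \<le> e\<^sup>2" using N_le by linarith
    then have "\<delta> * x i \<le> e"
      by (rule power2_le_imp_le) (use \<open>e > 0\<close> in linarith)
    moreover have "a v v (b i) + A v (b i) - f (b i) + \<delta> * x i = 0"
      using x[OF i] by (simp add: g_def v_def)
    moreover have "\<delta> * N \<ge> 0" using \<open>N \<ge> 0\<close> \<open>\<delta> > 0\<close> by simp
    moreover have "j (b i) - j v \<ge> A v (b i) - A v v"
      using convex_gateaux_above_tangent[OF j_convex j_deriv, of v "b i"]
      by (simp add: blinfun.diff_right)
    moreover have "a v v (b i - v) = a v v (b i) - a v v v"
      using lin[of v v] by (rule linear_diff)
    ultimately show ?thesis using eq by (simp add: blinfun.diff_right)
  qed
  with norm_v show ?thesis using that by blast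
qed

section \<open>Passage to the weak limit\<close>

text \<open>Solved for the diagonal term, the inequality reads
  \<open>a (x n) (x n) (x n) \<le> s n\<close> with \<open>s\<close> convergent. The lower limit of
  the left side is at least \<open>a v v v\<close>, so one-sided control of that term
  suffices.\<close>

lemma variational_inequality_weak_limit:
  fixes J :: "'a::real_normed_vector \<Rightarrow> real"
    and a :: "'a \<Rightarrow> 'a \<Rightarrow> 'a \<Rightarrow> real"
    and f :: "'a \<Rightarrow>\<^sub>L real"
  assumes J_weak: "weakly_continuous_functional J"
    and a_bilinear: "\<And>w. bilinear (a w)"
    and a_weak: "\<And>x v u. x \<rightharpoonup> v \<Longrightarrow> (\<lambda>m. a (x m) (x m) u) \<longlonglongrightarrow> a v v u"
    and a_liminf: "\<And>x v. x \<rightharpoonup> v \<Longrightarrow>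
        liminf (\<lambda>m. ereal (a (x m) (x m) (x m))) \<ge> ereal (a v v v)"
    and x: "x \<rightharpoonup> v" and e: "e \<longlonglongrightarrow> 0"
    and ineq: "\<And>n. a (x n) (x n) (u - x n) + J u - J (x n) \<ge> blinfun_apply f (u - x n) - e n"
  shows "a v v (u - v) + J u - J v \<ge> blinfun_apply f (u - v)"
proof -
  have diff: "a w w (u - w) = a w w u - a w w w" for w
    using a_bilinear[of w] by (simp add: bilinear_def linear_diff)
  define s where "s n = a (x n) (x n) u + J u - J (x n) - (f u - f (x n)) + e n" for n
  have "s \<longlonglongrightarrow> a v v u + J u - J v - (f u - f v) + 0"
    unfolding s_def using x J_weak
    by (intro tendsto_add tendsto_diff tendsto_const a_weak e)
      (auto simp: weakly_continuous_functional_def weakly_converges_def)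
  then have "liminf (\<lambda>n. ereal (s n)) = ereal (a v v u + J u - J v - (f u - f v))"
    by (intro lim_imp_Liminf) auto
  moreover have "liminf (\<lambda>n. ereal (a (x n) (x n) (x n))) \<le> liminf (\<lambda>n. ereal (s n))"
  proof (intro Liminf_mono always_eventually allI)
    show "ereal (a (x n) (x n) (x n)) \<le> ereal (s n)" for n
      using ineq[of n] by (simp add: s_def diff blinfun.diff_right)
  qed
  ultimately have "ereal (a v v v) \<le> ereal (a v v u + J u - J v - (f u - f v))"
    using a_liminf[OF x] order_trans by metis
  then show ?thesis by (simp add: diff blinfun.diff_right)
qed

section \<open>Existence and the norm estimate\<close>

theorem theorem4p3:
  fixes J :: "'a::{real_inner, complete_space} \<Rightarrow> real"
    and J\<^sub>\<epsilon> :: "real \<Rightarrow> 'a \<Rightarrow> real"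
    and A :: "real \<Rightarrow> 'a \<Rightarrow> ('a \<Rightarrow>\<^sub>L real)"
    and a :: "'a \<Rightarrow> 'a \<Rightarrow> 'a \<Rightarrow> real"
    and \<alpha> :: real
    and f :: "'a \<Rightarrow>\<^sub>L real"
  assumes separable: "separable_space (euclidean :: 'a topology)"
    and J_weak: "weakly_continuous_functional J"
    and J_convex: "convex_on UNIV J"
    and J\<epsilon>_convex: "\<And>\<epsilon>. \<epsilon> > 0 \<Longrightarrow> convex_on UNIV (J\<^sub>\<epsilon> \<epsilon>)"
    and J\<epsilon>_uniform: "uniform_limit UNIV J\<^sub>\<epsilon> J (at_right 0)"
    and J\<epsilon>_deriv: "\<And>\<epsilon> v. \<epsilon> > 0 \<Longrightarrow> has_gateaux_derivative (J\<^sub>\<epsilon> \<epsilon>) (A \<epsilon> v) v"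
    and A_weak: "\<And>\<epsilon>. \<epsilon> > 0 \<Longrightarrow> weakly_continuous_operator (A \<epsilon>)"
    and A_zero: "\<And>\<epsilon>. \<epsilon> > 0 \<Longrightarrow> A \<epsilon> 0 = 0"
    and a_bilinear: "\<And>w. bilinear (a w)"
    and \<alpha>_pos: "\<alpha> > 0"
    and a_coercive: "\<And>v. a v v v \<ge> \<alpha> * (norm v)\<^sup>2"
    and a_weak: "\<And>x v u. x \<rightharpoonup> v \<Longrightarrow> (\<lambda>m. a (x m) (x m) u) \<longlonglongrightarrow> a v v u"
    and a_liminf: "\<And>x v. x \<rightharpoonup> v \<Longrightarrow>
        liminf (\<lambda>m. ereal (a (x m) (x m) (x m))) \<ge> ereal (a v v v)"
  shows "\<exists>v. (\<forall>u. a v v (u - v) + J u - J v \<ge> blinfun_apply f (u - v)) \<and>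
             norm v \<le> 1 / \<alpha> * norm f"
proof -
  define R where "R = norm f / \<alpha>"
  define C where "C u = {v. norm v \<le> R \<and> a v v (u - v) + J u - J v \<ge> f (u - v)}" for u
  have weak_limit: "a v v (u - v) + J u - J v \<ge> f (u - v)"
    if "x \<rightharpoonup> v" "e \<longlonglongrightarrow> 0" "\<And>n. a (x n) (x n) (u - x n) + J u - J (x n) \<ge> f (u - x n) - e n"
    for x v e u
    using variational_inequality_weak_limit[OF J_weak a_bilinear _ _ that] a_weak a_liminf by blast
  have approx: "\<exists>v. norm v \<le> R \<and> (\<forall>u\<in>F. a v v (u - v) + J u - J v \<ge> f (u - v) - e)"
    if "finite F" "e > 0" for F e
  proof -
    \<comment> \<open>\<open>F\<close> is listed by the indices below \<open>p\<close>, while the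
      Galerkin problem uses those up to \<open>p\<close>; \<open>b p\<close> is one arbitrary extra
      vector, so an empty \<open>F\<close> is covered.\<close>
    obtain b :: "nat \<Rightarrow> 'a" and p where b: "F = b ` {i. i < p}"
      using finite_imp_nat_seg_image_inj_on[OF \<open>finite F\<close>] by blast
    \<comment> \<open>Uniformity matters because the Galerkin solution \<open>v\<close> depends on
      \<open>\<epsilon>\<close>. The error \<open>e\<close> is split between the Galerkin error and
      the exchange of functionals at \<open>b i\<close> and at \<open>v\<close>.\<close>
    have "\<forall>\<^sub>F \<epsilon> in at_right 0. \<forall>v. dist (J\<^sub>\<epsilon> \<epsilon> v) (J v) < e / 3"
      using uniform_limitD[OF J\<epsilon>_uniform, of "e / 3"] \<open>e > 0\<close> by simp
    moreover have "\<forall>\<^sub>F \<epsilon> in at_right (0::real). \<epsilon> > 0"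
      by (rule eventually_at_right_less)
    ultimately have "\<forall>\<^sub>F \<epsilon> in at_right 0. (\<forall>v. dist (J\<^sub>\<epsilon> \<epsilon> v) (J v) < e / 3) \<and> \<epsilon> > 0"
      by (rule eventually_conj)
    then obtain \<epsilon> where \<epsilon>: "\<And>v. dist (J\<^sub>\<epsilon> \<epsilon> v) (J v) < e / 3" "\<epsilon> > 0"
      using eventually_happens[of _ "at_right (0::real)"] by fastforce
    obtain v where v: "norm v \<le> norm f / \<alpha>"
      "\<And>i. i \<le> p \<Longrightarrow> a v v (b i - v) + J\<^sub>\<epsilon> \<epsilon> (b i) - J\<^sub>\<epsilon> \<epsilon> v \<ge> f (b i - v) - e / 3"
      using galerkin_approximation[OF J\<epsilon>_convex[OF \<epsilon>(2)] J\<epsilon>_deriv[OF \<epsilon>(2)] A_weak[OF \<epsilon>(2)]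
          A_zero[OF \<epsilon>(2)] a_bilinear \<alpha>_pos a_coercive a_weak, of "e / 3" f p b] \<open>e > 0\<close> by auto
    have "a v v (b i - v) + J (b i) - J v \<ge> f (b i - v) - e" if "i < p" for i
      using v(2)[of i] \<epsilon>(1)[of "b i"] \<epsilon>(1)[of v] that unfolding dist_real_def by linarith
    with v(1) show ?thesis unfolding R_def b by blast
  qed
  have "(\<Inter>u. C u) \<noteq> {}"
  proof (rule weakly_seq_closed_fip[OF separable])
    show "norm v \<le> R" if "v \<in> C u" for u v
      using that by (simp add: C_def)
    show "l \<in> C u" if x: "\<And>n. x n \<in> C u" "x \<rightharpoonup> l" for u x l
    proof -
      have "norm l \<le> R"
        using weak_limit_norm_le[OF x(2)] x(1) by (simp add: C_def)
      \<comment> \<open>Members of \<open>C u\<close> satisfy the exact inequality, so the error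
        sequence is constantly 0.\<close>
      moreover have "a l l (u - l) + J u - J l \<ge> f (u - l)"
        by (rule weak_limit[OF x(2) tendsto_const]) (use x(1) in \<open>auto simp: C_def\<close>)
      ultimately show ?thesis by (simp add: C_def)
    qed
    show "(\<Inter>u\<in>F. C u) \<noteq> {}" if "finite F" for F
    proof -
      \<comment> \<open>One sequence of approximate solutions serves all \<open>u\<close> in
        \<open>F\<close> at once, so a single weak limit lies in every \<open>C u\<close>.\<close>
      define e where "e n = inverse (real (Suc n))" for n
      have "\<exists>v. norm v \<le> R \<and> (\<forall>u\<in>F. a v v (u - v) + J u - J v \<ge> f (u - v) - e n)" for n
        using approx[OF that, of "e n"] by (simp add: e_def)
      then obtain x where x: "\<And>n. norm (x n) \<le> R"
        "\<And>n u. u \<in> F \<Longrightarrow> a (x n) (x n) (u - x n) + J u - J (x n) \<ge> f (u - x n) - e n"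
        by metis
      obtain r l where r: "strict_mono (r :: nat \<Rightarrow> nat)" "(x \<circ> r) \<rightharpoonup> l" "norm l \<le> R"
        using weakly_convergent_subsequence[OF separable, of x R] x(1) by blast
      have "(e \<circ> r) \<longlonglongrightarrow> 0"
        using LIMSEQ_subseq_LIMSEQ[OF LIMSEQ_inverse_real_of_nat r(1)] by (simp add: e_def o_def)
      then have "a l l (u - l) + J u - J l \<ge> f (u - l)" if "u \<in> F" for u
        by (rule weak_limit[OF r(2)]) (use x(2)[OF that] in simp)
      with r(3) have "l \<in> (\<Inter>u\<in>F. C u)" by (simp add: C_def)
      then show ?thesis by blast
    qed
  qed
  then obtain v where "\<And>u. v \<in> C u" by blast
  then show ?thesis by (auto simp: C_def R_def)
qed

end
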